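(* For every strong double broom $G$, $dern(G)\in\{1,2\}$.
   Context: All graphs are finite, simple and undirected. For an edge $e$ of a graph $G$, $d(e)$ is the number of edges of $G$ adjacent to $e$. A da-ecard of $G$ is the pair $(d(e),G-e)$ with $G-e$ unlabeled; the da-edeck is the multiset of all da-ecards. $dern(G)$ (degree associated edge reconstruction number) is the size of the smallest sub-multiset of the da-edeck of $G$ not contained in the da-edeck of any graph $H\not\cong G$. A strong double broom is a graph on at least 5 vertices obtained from a union of at least two internally vertex disjoint paths with common ends $u$ and $v$ by appending at least one leaf at $u$ and at least one leaf at $v$. *)

theory Defs
  imports "HOL-Library.Multiset" "HOL-Library.Extended_Nat"
begin

record 'a ugraph =
  verts :: "'a set"
  edges :: "'a set set"

definition fin_simple_graph :: "'a ugraph \<Rightarrow> bool" where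
  "fin_simple_graph G \<longleftrightarrow>
     finite (verts G) \<and> (\<forall>e \<in> edges G. e \<subseteq> verts G \<and> card e = 2)"

definition graph_iso :: "'a ugraph \<Rightarrow> 'b ugraph \<Rightarrow> bool" (infix "\<simeq>" 50) where
  "G \<simeq> H \<longleftrightarrow>
     (\<exists>f. bij_betw f (verts G) (verts H) \<and> (`) f ` edges G = edges H)"

definition delete_edge :: "'a ugraph \<Rightarrow> 'a set \<Rightarrow> 'a ugraph" where
  "delete_edge G e = \<lparr>verts = verts G, edges = edges G - {e}\<rparr>"

definition edge_degree :: "'a ugraph \<Rightarrow> 'a set \<Rightarrow> nat" where
  "edge_degree G e = card {f \<in> edges G. f \<noteq> e \<and> f \<inter> e \<noteq> {}}"

text \<open>An unlabeled finite graph is represented by its isomorphism class among the graphs with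
  vertices in \<^typ>\<open>nat\<close>. Every finite graph, whatever its vertex type, has such a copy; see
  \<open>unlabeled_eq_iff\<close> below.\<close>

definition unlabeled :: "'a ugraph \<Rightarrow> nat ugraph set" where
  "unlabeled G = {H. G \<simeq> H}"

definition da_ecard :: "'a ugraph \<Rightarrow> 'a set \<Rightarrow> nat \<times> nat ugraph set" where
  "da_ecard G e = (edge_degree G e, unlabeled (delete_edge G e))"

definition da_edeck :: "'a ugraph \<Rightarrow> (nat \<times> nat ugraph set) multiset" where
  "da_edeck G = image_mset (da_ecard G) (mset_set (edges G))"

text \<open>The infimum is taken in \<^typ>\<open>enat\<close>, so that \<open>dern G = \<infinity>\<close> if not even the whole da-edeck
  determines \<open>G\<close>. Since every finite graph has a copy on \<^typ>\<open>nat\<close>, letting \<open>H\<close> range over graphs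
  with vertices in \<^typ>\<open>nat\<close> accounts for all finite graphs.\<close>

definition determines :: "(nat \<times> nat ugraph set) multiset \<Rightarrow> 'a ugraph \<Rightarrow> bool" where
  "determines M G \<longleftrightarrow>
     (\<forall>H :: nat ugraph. fin_simple_graph H \<and> \<not> H \<simeq> G \<longrightarrow> \<not> M \<subseteq># da_edeck H)"

definition dern :: "'a ugraph \<Rightarrow> enat" where
  "dern G = Inf {enat (size M) | M. M \<subseteq># da_edeck G \<and> determines M G}"

definition path_edges :: "'a list \<Rightarrow> 'a set set" where
  "path_edges p = {{p ! i, p ! Suc i} | i. Suc i < length p}"

definition is_path :: "'a \<Rightarrow> 'a list \<Rightarrow> 'a \<Rightarrow> bool" where
  "is_path u p v \<longleftrightarrow> p \<noteq> [] \<and> distinct p \<and> hd p = u \<and> last p = v"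

text \<open>\<open>P\<close> is the set of paths (each listed as a vertex sequence from \<open>u\<close> to \<open>v\<close>), \<open>A\<close> and \<open>B\<close> are
  the sets of leaves appended at \<open>u\<close> and \<open>v\<close>. As \<open>P\<close> is a set, at most one of the paths is the
  single edge \<open>uv\<close>; \<open>2 \<le> card P\<close> includes that \<open>P\<close> is finite.\<close>

definition strong_double_broom :: "'a ugraph \<Rightarrow> bool" where
  "strong_double_broom G \<longleftrightarrow>
     fin_simple_graph G \<and> 5 \<le> card (verts G) \<and>
     (\<exists>u v P A B.
        u \<noteq> v \<and>
        2 \<le> card P \<and> (\<forall>p \<in> P. is_path u p v) \<and>
        (\<forall>p \<in> P. \<forall>q \<in> P. p \<noteq> q \<longrightarrow> set p \<inter> set q = {u, v}) \<and>
        A \<noteq> {} \<and> B \<noteq> {} \<and> A \<inter> B = {} \<and> (A \<union> B) \<inter> (\<Union>p\<in>P. set p) = {} \<and>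
        verts G = (\<Union>p\<in>P. set p) \<union> A \<union> B \<and>
        edges G = (\<Union>p\<in>P. path_edges p) \<union> {{u, a} | a. a \<in> A} \<union> {{v, b} | b. b \<in> B})"

lemma graph_iso_refl: "G \<simeq> G"
  unfolding graph_iso_def by (rule exI[of _ id]) simp

lemma graph_iso_trans: "G \<simeq> H \<Longrightarrow> H \<simeq> K \<Longrightarrow> G \<simeq> K"
  unfolding graph_iso_def
proof (elim exE conjE)
  fix f g
  assume f: "bij_betw f (verts G) (verts H)" "(`) f ` edges G = edges H"
    and g: "bij_betw g (verts H) (verts K)" "(`) g ` edges H = edges K"
  have "bij_betw (g \<circ> f) (verts G) (verts K)"
    using f(1) g(1) by (rule bij_betw_trans)
  moreover have "(`) (g \<circ> f) ` edges G = edges K"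
    
    by (simp only: f(2)[symmetric] g(2)[symmetric] image_image comp_def)
  ultimately show "\<exists>h. bij_betw h (verts G) (verts K) \<and> (`) h ` edges G = edges K"
    by blast
qed

lemma graph_iso_sym:
  assumes "fin_simple_graph G" "G \<simeq> H"
  shows "H \<simeq> G"
proof -
  from assms(2) obtain f where f: "bij_betw f (verts G) (verts H)" "(`) f ` edges G = edges H"
    unfolding graph_iso_def by blast
  define g where "g = inv_into (verts G) f"
  have g: "bij_betw g (verts H) (verts G)"
    unfolding g_def using f(1) by (rule bij_betw_inv_into)
  have "g ` f ` e = e" if "e \<in> edges G" for e
  proof -
    have "e \<subseteq> verts G" using that assms(1) by (auto simp: fin_simple_graph_def)
    then show ?thesis
      unfolding g_def using f(1) by (simp add: bij_betw_def inv_into_image_cancel)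
  qed
  then have "(`) g ` edges H = edges G"
    unfolding f(2)[symmetric] by (simp add: image_image)
  with g show ?thesis unfolding graph_iso_def by blast
qed

lemma fin_simple_graph_iso:
  assumes "fin_simple_graph G" "G \<simeq> H"
  shows "fin_simple_graph H"
proof -
  from assms(2) obtain f where f: "bij_betw f (verts G) (verts H)" "(`) f ` edges G = edges H"
    unfolding graph_iso_def by blast
  have "f ` e \<subseteq> verts H \<and> card (f ` e) = 2" if "e \<in> edges G" for e
  proof -
    have "e \<subseteq> verts G" "card e = 2" using that assms(1) by (auto simp: fin_simple_graph_def)
    moreover have "inj_on f e" using f(1) \<open>e \<subseteq> verts G\<close> by (auto simp: bij_betw_def inj_on_subset)
    ultimately show ?thesis using f(1) by (auto simp: bij_betw_def card_image)
  qed
  moreover have "finite (verts H)"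
    using assms(1) f(1) bij_betw_finite by (auto simp: fin_simple_graph_def)
  ultimately show ?thesis
    unfolding fin_simple_graph_def f(2)[symmetric] by blast
qed

lemma unlabeled_nonempty:
  assumes "fin_simple_graph G"
  shows "unlabeled G \<noteq> {}"
proof -
  obtain f :: "'a \<Rightarrow> nat" where "inj_on f (verts G)"
    using assms finite_imp_inj_to_nat_seg[of "verts G"] by (auto simp: fin_simple_graph_def)
  then have "G \<simeq> \<lparr>verts = f ` verts G, edges = (`) f ` edges G\<rparr>"
    unfolding graph_iso_def by (auto simp: bij_betw_def)
  then show ?thesis unfolding unlabeled_def by blast
qed

lemma unlabeled_eq_iff:
  assumes "fin_simple_graph G" "fin_simple_graph H"
  shows "unlabeled G = unlabeled H \<longleftrightarrow> G \<simeq> H"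
proof
  assume eq: "unlabeled G = unlabeled H"
  obtain K where "K \<in> unlabeled G"
    using unlabeled_nonempty[OF assms(1)] by blast
  moreover from this have "K \<in> unlabeled H"
    by (simp only: eq)
  ultimately have "G \<simeq> K" "H \<simeq> K"
    by (simp_all only: unlabeled_def mem_Collect_eq)
  from \<open>G \<simeq> K\<close> graph_iso_sym[OF assms(2) \<open>H \<simeq> K\<close>] show "G \<simeq> H"
    by (rule graph_iso_trans)
next
  assume GH: "G \<simeq> H"
  have HG: "H \<simeq> G" using assms(1) GH by (rule graph_iso_sym)
  show "unlabeled G = unlabeled H"
    unfolding unlabeled_def
    by (rule Collect_cong, rule iffI, erule graph_iso_trans[OF HG], erule graph_iso_trans[OF GH])
qed

end

theory Submission
  imports Defs
begin

text \<open>Take the cards of a leaf edge \<open>uw\<close> and of a path edge. The latter has no isolated vertex, so a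
  graph \<open>H\<close> with both cards arises from \<open>G - uw\<close> by joining the isolated vertex \<open>w\<close> to some \<open>z\<close>, and
  the edge degrees give \<open>z = u\<close> or \<open>deg z = deg u - 1\<close>. If \<open>z = v\<close>, then the numbers of leaves at \<open>u\<close>
  and \<open>v\<close> are merely exchanged and \<open>H\<close> is isomorphic to \<open>G\<close>. An inner vertex \<open>z\<close> requires two paths
  and a single leaf at \<open>u\<close>; by symmetry this leaves the case of a cycle with one pendant vertex at
  each of \<open>u\<close> and \<open>v\<close>. There \<open>H\<close> is again a cycle with two pendant vertices, and a suitable path edge
  shows the distances along the cycle between the vertices of degree 3.\<close>

section \<open>Degrees, isomorphisms and cards\<close>

definition degree :: "'a ugraph \<Rightarrow> 'a \<Rightarrow> nat" where
  "degree G x = card {e \<in> edges G. x \<in> e}"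

text \<open>With the bijection as an argument, particular vertices, edges and paths can be followed
  from one graph to the other.\<close>

definition iso_via :: "('a \<Rightarrow> 'b) \<Rightarrow> 'a ugraph \<Rightarrow> 'b ugraph \<Rightarrow> bool" where
  "iso_via f G H \<longleftrightarrow> bij_betw f (verts G) (verts H) \<and> (`) f ` edges G = edges H"

lemma graph_iso_iff_iso_via: "G \<simeq> H \<longleftrightarrow> (\<exists>f. iso_via f G H)"
  by (simp add: graph_iso_def iso_via_def)

lemma finite_edges: "fin_simple_graph G \<Longrightarrow> finite (edges G)"
  unfolding fin_simple_graph_def by (meson PowI finite_Pow_iff finite_subset subsetI)

lemma edge_subset: "fin_simple_graph G \<Longrightarrow> e \<in> edges G \<Longrightarrow> e \<subseteq> verts G"
  by (simp add: fin_simple_graph_def)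

lemma edge_eqI:
  assumes "fin_simple_graph G" "e \<in> edges G" "x \<in> e" "y \<in> e" "x \<noteq> y"
  shows "e = {x, y}"
proof -
  have "card e = 2" using assms by (simp add: fin_simple_graph_def)
  then obtain a b where "e = {a, b}" by (meson card_2_iff)
  then show ?thesis using assms by auto
qed

lemma fin_simple_delete_edge: "fin_simple_graph G \<Longrightarrow> fin_simple_graph (delete_edge G e)"
  by (simp add: fin_simple_graph_def delete_edge_def)

lemma verts_delete_edge [simp]: "verts (delete_edge G e) = verts G"
  and edges_delete_edge [simp]: "edges (delete_edge G e) = edges G - {e}"
  by (simp_all add: delete_edge_def)

text \<open>The subtraction is never truncated: if \<open>x \<in> e\<close>, then \<open>e\<close>
  itself is counted in \<open>degree G x\<close>.\<close>

lemma degree_delete_edge: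
  assumes "fin_simple_graph G" "e \<in> edges G"
  shows "degree (delete_edge G e) x = degree G x - (if x \<in> e then 1 else 0)"
proof (cases "x \<in> e")
  case True
  have "{f \<in> edges (delete_edge G e). x \<in> f} = {f \<in> edges G. x \<in> f} - {e}" by auto
  then show ?thesis using True assms finite_edges[OF assms(1)]
    by (simp add: degree_def)
next
  case False
  then have "{f \<in> edges (delete_edge G e). x \<in> f} = {f \<in> edges G. x \<in> f}" by auto
  then show ?thesis using False by (simp add: degree_def)
qed

text \<open>Apart from \<open>{x, y}\<close>, no edge contains both \<open>x\<close> and
  \<open>y\<close>, so the adjacent edges split into those at \<open>x\<close> and those at
  \<open>y\<close>. The edge itself is counted in each degree, which accounts for the 2.\<close>

lemma edge_degree_eq:
  assumes G: "fin_simple_graph G" and xy: "{x, y} \<in> edges G" "x \<noteq> y"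
  shows "edge_degree G {x, y} + 2 = degree G x + degree G y"
proof -
  let ?X = "{f \<in> edges G. x \<in> f}" and ?Y = "{f \<in> edges G. y \<in> f}"
  have fin: "finite ?X" "finite ?Y" using finite_edges[OF G] by auto
  have eq: "{f \<in> edges G. f \<noteq> {x, y} \<and> f \<inter> {x, y} \<noteq> {}} = (?X - {{x, y}}) \<union> (?Y - {{x, y}})"
    by auto
  have "(?X - {{x, y}}) \<inter> (?Y - {{x, y}}) = {}"
    using edge_eqI[OF G _ _ _ xy(2)] by auto
  then have "edge_degree G {x, y} = card (?X - {{x, y}}) + card (?Y - {{x, y}})"
    unfolding edge_degree_def eq using fin by (simp add: card_Un_disjoint)
  moreover have "card ?X = Suc (card (?X - {{x, y}}))" "card ?Y = Suc (card (?Y - {{x, y}}))"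
    by (rule card.remove; use fin xy(1) in simp)+
  ultimately show ?thesis by (simp add: degree_def)
qed

lemma inj_on_image_edges:
  assumes "fin_simple_graph G" "iso_via f G H"
  shows "inj_on ((`) f) (edges G)"
proof -
  have "inj_on f (verts G)" using assms(2) by (simp add: iso_via_def bij_betw_def)
  then have "inj_on ((`) f) (Pow (verts G))" by (rule inj_on_image_Pow)
  then show ?thesis
    by (rule inj_on_subset) (auto dest: edge_subset[OF assms(1)])
qed

lemma iso_via_mem_image:
  assumes "fin_simple_graph G" "iso_via f G H" "e \<in> edges G" "x \<in> verts G"
  shows "f x \<in> f ` e \<longleftrightarrow> x \<in> e"
  using assms edge_subset[OF assms(1,3)] inj_on_image_mem_iff[of f "verts G" x e]
  by (simp add: iso_via_def bij_betw_def)

lemma iso_via_degree: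
  assumes G: "fin_simple_graph G" and f: "iso_via f G H" and x: "x \<in> verts G"
  shows "degree H (f x) = degree G x"
proof -
  have "{e \<in> edges H. f x \<in> e} = (`) f ` {e \<in> edges G. x \<in> e}"
  proof -
    have "edges H = (`) f ` edges G" using f by (simp add: iso_via_def)
    then show ?thesis using iso_via_mem_image[OF G f _ x] by auto
  qed
  moreover have "inj_on ((`) f) {e \<in> edges G. x \<in> e}"
    using inj_on_image_edges[OF G f] by (rule inj_on_subset) auto
  ultimately show ?thesis by (simp add: degree_def card_image)
qed

lemma iso_via_edge_degree:
  assumes G: "fin_simple_graph G" and f: "iso_via f G H" and e: "e \<in> edges G"
  shows "edge_degree H (f ` e) = edge_degree G e"
proof -
  obtain x y where xy: "e = {x, y}" "x \<noteq> y"
    using G e by (auto simp: fin_simple_graph_def card_2_iff)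
  have v: "x \<in> verts G" "y \<in> verts G" using edge_subset[OF G e] xy by auto
  then have ne: "f x \<noteq> f y" using f xy(2) by (auto simp: iso_via_def bij_betw_def inj_on_def)
  have H: "fin_simple_graph H"
    using fin_simple_graph_iso[OF G] f by (auto simp: graph_iso_iff_iso_via)
  have "f ` e \<in> edges H" using f e by (auto simp: iso_via_def)
  then have "edge_degree H (f ` e) + 2 = degree H (f x) + degree H (f y)"
    using edge_degree_eq[OF H _ ne] xy(1) by simp
  moreover have "edge_degree G e + 2 = degree G x + degree G y"
    using edge_degree_eq[OF G _ xy(2)] e xy(1) by simp
  ultimately show ?thesis using iso_via_degree[OF G f] v by simp
qed

lemma iso_via_delete_edge:
  assumes "fin_simple_graph G" "iso_via f G H" "e \<in> edges G"
  shows "iso_via f (delete_edge G e) (delete_edge H (f ` e))"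
proof -
  have "(`) f ` (edges G - {e}) = (`) f ` edges G - (`) f ` {e}"
    using inj_on_image_edges[OF assms(1,2)] assms(3)
    by (auto simp: inj_on_def)
  then show ?thesis using assms(2) by (simp add: iso_via_def)
qed

section \<open>Graphs that share da-ecards\<close>

lemma da_ecard_eqD:
  assumes "fin_simple_graph G" "fin_simple_graph H" "da_ecard G e = da_ecard H f"
  shows "edge_degree G e = edge_degree H f" "delete_edge G e \<simeq> delete_edge H f"
  using assms unlabeled_eq_iff[OF fin_simple_delete_edge[OF assms(1)] fin_simple_delete_edge[OF assms(2)]]
  by (auto simp: da_ecard_def)

text \<open>Deleting an edge keeps all vertices, so an isomorphism between the cards is defined on
  the whole of \<open>H\<close> and relabels also the deleted edge \<open>f\<close>. After the
  relabelling the two cards are equal, not merely isomorphic, and the copy \<open>H'\<close> lives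
  on the vertex type of \<open>G\<close>.\<close>

lemma card_pullback:
  fixes G :: "'a ugraph" and H :: "'b ugraph"
  assumes G: "fin_simple_graph G" and H: "fin_simple_graph H"
    and f: "f \<in> edges H" and iso: "delete_edge H f \<simeq> delete_edge G e"
  obtains g and H' :: "'a ugraph"
  where "iso_via g H H'" "verts H' = verts G" "edges H' - {g ` f} = edges G - {e}"
proof -
  obtain g where g: "iso_via g (delete_edge H f) (delete_edge G e)"
    using iso by (auto simp: graph_iso_iff_iso_via)
  define H' where "H' = \<lparr>verts = verts G, edges = (`) g ` edges H\<rparr>"
  have gH: "iso_via g H H'" using g by (simp add: iso_via_def H'_def)
  have "(`) g ` edges (delete_edge H f) = edges (delete_edge H' (g ` f))"
    using iso_via_delete_edge[OF H gH f] unfolding iso_via_def by blast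
  then have "edges H' - {g ` f} = edges G - {e}"
    using g by (simp add: iso_via_def)
  with gH show ?thesis by (intro that[of g H']) (simp_all add: H'_def)
qed

text \<open>A graph sharing two da-ecards with \<open>G\<close> may be assumed to have the vertices of \<open>G\<close> and to
  differ from \<open>G\<close> in one edge only.\<close>

lemma determines_two_ecards:
  fixes G :: "'a ugraph"
  assumes G: "fin_simple_graph G" and e1: "e1 \<in> edges G" and e2: "e2 \<in> edges G" and ne: "e1 \<noteq> e2"
    and rec: "\<And>(H :: 'a ugraph) f1 f2. \<lbrakk>fin_simple_graph H; verts H = verts G;
      f1 \<in> edges H; edges H - {f1} = edges G - {e1}; edge_degree H f1 = edge_degree G e1;
      f2 \<in> edges H; edge_degree H f2 = edge_degree G e2; delete_edge G e2 \<simeq> delete_edge H f2\<rbrakk>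
      \<Longrightarrow> G \<simeq> H"
  shows "\<exists>M. M \<subseteq># da_edeck G \<and> size M = 2 \<and> determines M G"
proof (intro exI conjI)
  let ?M = "image_mset (da_ecard G) (mset_set {e1, e2})"
  show "?M \<subseteq># da_edeck G"
    unfolding da_edeck_def using e1 e2 finite_edges[OF G]
    by (intro image_mset_subseteq_mono) (simp add: subset_imp_msubset_mset_set)
  show "size ?M = 2" using ne by simp
  show "determines ?M G"
    unfolding determines_def
  proof (intro allI impI notI, elim conjE)
    fix H :: "nat ugraph"
    assume H: "fin_simple_graph H" and not: "\<not> H \<simeq> G" and sub: "?M \<subseteq># da_edeck H"
    \<comment> \<open>Only membership of each card in the deck is extracted, so the edges
      \<open>h1\<close> and \<open>h2\<close> found below may coincide; accordingly
      \<open>rec\<close> has to cope with \<open>f1 = f2\<close>.\<close>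
    have shared: "da_ecard G e \<in> da_ecard H ` edges H" if "e \<in> {e1, e2}" for e
    proof -
      have "da_ecard G e \<in># ?M" using that by auto
      then have "da_ecard G e \<in># da_edeck H" using sub by (meson mset_subset_eqD)
      then show ?thesis using finite_edges[OF H] by (simp add: da_edeck_def)
    qed
    obtain h1 where h1: "h1 \<in> edges H" "da_ecard G e1 = da_ecard H h1"
      using shared[of e1] by auto
    obtain h2 where h2: "h2 \<in> edges H" "da_ecard G e2 = da_ecard H h2"
      using shared[of e2] by auto
    note h = h1(1) h2(1) h1(2) h2(2)
    note d1 = da_ecard_eqD[OF G H h(3)] and d2 = da_ecard_eqD[OF G H h(4)]
    have "delete_edge H h1 \<simeq> delete_edge G e1"
      using d1(2) graph_iso_sym[OF fin_simple_delete_edge[OF G]] by blast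
    from card_pullback[OF G H h(1) this] obtain g and H' :: "'a ugraph" where
      g: "iso_via g H H'" and H': "verts H' = verts G" "edges H' - {g ` h1} = edges G - {e1}" .
    have HH': "H \<simeq> H'" using g by (auto simp: graph_iso_iff_iso_via)
    have "delete_edge H h2 \<simeq> delete_edge H' (g ` h2)"
      using iso_via_delete_edge[OF H g h(2)] by (auto simp: graph_iso_iff_iso_via)
    then have "delete_edge G e2 \<simeq> delete_edge H' (g ` h2)"
      using d2(2) graph_iso_trans by blast
    moreover have "g ` h1 \<in> edges H'" "g ` h2 \<in> edges H'"
      using g h by (auto simp: iso_via_def)
    ultimately have "G \<simeq> H'"
      using rec[of H' "g ` h1" "g ` h2"] H' fin_simple_graph_iso[OF H HH']
        iso_via_edge_degree[OF H g h(1)] iso_via_edge_degree[OF H g h(2)] d1(1) d2(1)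
      by simp
    then have "H \<simeq> G" using HH' graph_iso_sym[OF G] graph_iso_trans by blast
    with not show False ..
  qed
qed

text \<open>The lower bound holds because the empty multiset lies in every deck, also in that of a
  graph not isomorphic to \<open>G\<close>; the upper bound is the given pair of cards.\<close>

lemma dern_in_1_2:
  fixes G :: "'a ugraph"
  assumes ne: "verts G \<noteq> {}" and ex: "\<exists>M. M \<subseteq># da_edeck G \<and> size M = 2 \<and> determines M G"
  shows "dern G \<in> {1, 2}"
proof -
  let ?S = "{enat (size M) | M. M \<subseteq># da_edeck G \<and> determines M G}"
  have "\<not> determines {#} G"
  proof
    assume "determines {#} G"
    \<comment> \<open>The graph without vertices is not isomorphic to \<open>G\<close>, so it
      refutes the empty multiset.\<close>
    moreover define E :: "nat ugraph" where "E = \<lparr>verts = {}, edges = {}\<rparr>"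
    ultimately have "E \<simeq> G \<or> \<not> fin_simple_graph E"
      unfolding determines_def by (meson subset_mset.zero_le)
    then show False using ne by (auto simp: E_def fin_simple_graph_def graph_iso_def bij_betw_def)
  qed
  then have "1 \<le> x" if "x \<in> ?S" for x
    using that by (auto simp: one_enat_def Suc_le_eq simp flip: nonempty_has_size)
  then have "1 \<le> dern G" unfolding dern_def by (auto intro: Inf_greatest)
  moreover have "enat 2 \<in> ?S" using ex by fastforce
  then have "dern G \<le> enat 2" unfolding dern_def by (rule Inf_lower)
  ultimately show ?thesis
    by (cases "dern G") (auto simp: one_enat_def numeral_eq_enat)
qed

section \<open>Moving a leaf\<close>

text \<open>Deleting a leaf edge isolates the leaf. In a graph without isolated vertices, the edge
  put back must therefore cover that vertex.\<close>

definition no_isolated :: "'a ugraph \<Rightarrow> bool" where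
  "no_isolated G \<longleftrightarrow> (\<forall>x\<in>verts G. degree G x > 0)"

lemma no_isolated_iso:
  assumes "fin_simple_graph G" "G \<simeq> H" "no_isolated G"
  shows "no_isolated H"
proof -
  obtain f where f: "iso_via f G H" using assms(2) by (auto simp: graph_iso_iff_iso_via)
  then have "verts H = f ` verts G" by (simp add: iso_via_def bij_betw_def)
  then show ?thesis using assms(3) iso_via_degree[OF assms(1) f] by (auto simp: no_isolated_def)
qed

text \<open>In the common card \<open>w\<close> is isolated, so \<open>f\<close> joins
  \<open>w\<close> to some \<open>z\<close>, and \<open>w\<close> is a leaf of \<open>H\<close> as
  well. Equal edge degrees then give \<open>z\<close> in \<open>H\<close> the degree that
  \<open>u\<close> has in \<open>G\<close>. For \<open>z \<noteq> u\<close> the edge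
  \<open>f\<close> is the only change at \<open>z\<close>, hence the degree of \<open>z\<close> in
  \<open>G\<close> is smaller by one.\<close>

lemma moved_leaf:
  assumes G: "fin_simple_graph G" and H: "fin_simple_graph H" "verts H = verts G" "no_isolated H"
    and w: "{u, w} \<in> edges G" "u \<noteq> w" "degree G w = 1"
    and f: "f \<in> edges H" "edges H - {f} = edges G - {{u, w}}"
      "edge_degree H f = edge_degree G {u, w}"
  shows "H = G \<or> (\<exists>z \<in> verts G. z \<noteq> u \<and> z \<noteq> w \<and>
    H = \<lparr>verts = verts G, edges = insert {z, w} (edges G - {{u, w}})\<rparr> \<and>
    Suc (degree G z) = degree G u)"
proof -
  have wv: "w \<in> verts G" "u \<in> verts G" using edge_subset[OF G w(1)] by auto
  have del: "degree (delete_edge H f) x = degree (delete_edge G {u, w}) x" for x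
    using f(2) by (simp add: degree_def)
  have dw: "degree (delete_edge H f) w = 0"
    using del degree_delete_edge[OF G w(1)] w(3) by simp
  have "degree H w > 0" using H wv by (simp add: no_isolated_def)
  with dw have "w \<in> f" using degree_delete_edge[OF H(1) f(1), of w] by (auto split: if_splits)
  have "card f = 2" using H(1) f(1) by (simp add: fin_simple_graph_def)
  with \<open>w \<in> f\<close> obtain z where z: "f = {z, w}" "z \<noteq> w" by (auto simp: card_2_iff)
  have zv: "z \<in> verts G" using edge_subset[OF H(1) f(1)] z H(2) by auto
  have HE: "H = \<lparr>verts = verts G, edges = insert {z, w} (edges G - {{u, w}})\<rparr>"
  proof -
    have "edges H = insert {z, w} (edges G - {{u, w}})" using f(1,2) z(1) by blast
    then show ?thesis using H(2) by (cases H) simp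
  qed
  show ?thesis
  proof (cases "z = u")
    case True
    then show ?thesis using HE w(1) by (simp add: insert_absorb)
  next
    case False
    have "degree H w = 1"
      using dw degree_delete_edge[OF H(1) f(1), of w] z \<open>degree H w > 0\<close> by simp
    moreover have "edge_degree H f + 2 = degree H z + degree H w"
      using edge_degree_eq[OF H(1), of z w] f(1) z by simp
    moreover have "edge_degree G {u, w} + 2 = degree G u + degree G w"
      using edge_degree_eq[OF G w(1,2)] .
    ultimately have "degree H z = degree G u" using f(3) w(3) by simp
    moreover have "degree H z - 1 = degree G z"
      using del[of z] degree_delete_edge[OF H(1) f(1), of z] degree_delete_edge[OF G w(1), of z]
        z False by simp
    moreover have "degree H z > 0"
      using f(1) z finite_edges[OF H(1)] by (auto simp: degree_def card_gt_0_iff)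
    ultimately have "Suc (degree G z) = degree G u" by simp
    then show ?thesis using False z zv HE by blast
  qed
qed

section \<open>Double brooms\<close>

lemma path_edges_Nil [simp]: "path_edges [] = {}"
  and path_edges_single [simp]: "path_edges [x] = {}"
  by (simp_all add: path_edges_def)

text \<open>Replaces the description by indices with a recursion, on which the inductions over lists
  rest.\<close>

lemma path_edges_Cons_Cons [simp]:
  "path_edges (x # y # zs) = insert {x, y} (path_edges (y # zs))"
proof -
  have "{{(x # y # zs) ! i, (x # y # zs) ! Suc i} |i. Suc i < length (x # y # zs)} =
    insert {x, y} {{(y # zs) ! i, (y # zs) ! Suc i} |i. Suc i < length (y # zs)}" (is "?L = ?R")
  proof
    show "?L \<subseteq> ?R"
    proof
      fix e assume "e \<in> ?L"
      then obtain i where "e = {(x # y # zs) ! i, (y # zs) ! i}" "i < length (y # zs)" by auto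
      then show "e \<in> ?R" by (cases i) auto
    qed
    show "?R \<subseteq> ?L"
    proof
      fix e assume "e \<in> ?R"
      then consider "e = {x, y}" | i where "e = {(y # zs) ! i, (y # zs) ! Suc i}" "Suc i < length (y # zs)"
        by blast
      then show "e \<in> ?L"
      proof cases
        case 1
        then show ?thesis by (auto intro!: exI[of _ 0])
      next
        case 2
        then show ?thesis by (auto intro!: exI[of _ "Suc i"])
      qed
    qed
  qed
  then show ?thesis by (simp add: path_edges_def)
qed

text \<open>The vertex \<open>y\<close> at the cut occurs in both pieces; otherwise the edge across
  the cut would be lost.\<close>

lemma path_edges_append: "path_edges (xs @ y # ys) = path_edges (xs @ [y]) \<union> path_edges (y # ys)"
proof (induction xs)
  case (Cons x xs)
  then show ?case by (cases xs) auto
qed simp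

lemma path_edges_rev [simp]: "path_edges (rev p) = path_edges p"
proof (induction p)
  case (Cons x p)
  then show ?case
  proof (cases p)
    case (Cons y zs)
    have "path_edges (rev (x # p)) = path_edges (rev zs @ [y]) \<union> path_edges [y, x]"
      using path_edges_append[of "rev zs" y "[x]"] by (simp add: Cons)
    then show ?thesis using Cons.IH by (auto simp: Cons)
  qed simp
qed simp

lemma is_path_rev: "is_path u p v \<Longrightarrow> is_path v (rev p) u"
  by (auto simp: is_path_def hd_rev last_rev)

lemma path_edges_map: "path_edges (map f p) = (`) f ` path_edges p"
proof (induction p)
  case (Cons x p)
  then show ?case by (cases p) auto
qed simp

lemma path_edgesI: "Suc i < length p \<Longrightarrow> {p ! i, p ! Suc i} \<in> path_edges p"
  by (auto simp: path_edges_def)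

lemma path_edges_subset: "e \<in> path_edges p \<Longrightarrow> e \<subseteq> set p"
  by (auto simp: path_edges_def)

section \<open>Structure and degrees of a broom\<close>

text \<open>What \<open>strong_double_broom\<close> asserts to exist is a parameter here, so that
  the reversed broom and the competing graph \<open>H\<close> can be interpreted with their own
  ends, paths and leaves.\<close>

locale broom =
  fixes G :: "'a ugraph" and u v :: 'a and P :: "'a list set" and A B :: "'a set"
  assumes simple: "fin_simple_graph G"
    and u_neq_v: "u \<noteq> v"
    and card_P: "2 \<le> card P"
    and path: "p \<in> P \<Longrightarrow> is_path u p v"
    and inter: "p \<in> P \<Longrightarrow> q \<in> P \<Longrightarrow> p \<noteq> q \<Longrightarrow> set p \<inter> set q = {u, v}"
    and A_ne: "A \<noteq> {}" and B_ne: "B \<noteq> {}" and A_B: "A \<inter> B = {}"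
    and leaves_paths: "(A \<union> B) \<inter> (\<Union>p\<in>P. set p) = {}"
    and verts_eq: "verts G = (\<Union>p\<in>P. set p) \<union> A \<union> B"
    and edges_eq: "edges G = (\<Union>p\<in>P. path_edges p) \<union> {{u, a} | a. a \<in> A} \<union> {{v, b} | b. b \<in> B}"
begin

text \<open>The symmetry between the ends: every fact about \<open>u\<close> and \<open>A\<close>
  yields one about \<open>v\<close> and \<open>B\<close>.\<close>

lemma flip: "broom G v u (rev ` P) B A"
proof
  show "2 \<le> card (rev ` P)" using card_P by (simp add: card_image)
  show "is_path v p u" if "p \<in> rev ` P" for p
    using that by (auto intro!: is_path_rev path)
  show "set p \<inter> set q = {v, u}" if pq: "p \<in> rev ` P" "q \<in> rev ` P" "p \<noteq> q" for p q
  proof -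
    obtain p' where "p = rev p'" "p' \<in> P" using pq by blast
    moreover obtain q' where "q = rev q'" "q' \<in> P" using pq by blast
    ultimately show ?thesis using inter[of p' q'] pq(3) by auto
  qed
  show "verts G = \<Union> (set ` rev ` P) \<union> B \<union> A" using verts_eq by auto
  show "edges G = \<Union> (path_edges ` rev ` P) \<union> {{v, a} |a. a \<in> B} \<union> {{u, b} |b. b \<in> A}"
    using edges_eq by auto
  show "(B \<union> A) \<inter> \<Union> (set ` rev ` P) = {}" using leaves_paths by (simp add: Un_commute)
  show "B \<inter> A = {}" using A_B by blast
qed (use simple u_neq_v A_ne B_ne in simp_all)

lemma finite_P: "finite P" using card_P by (metis card.infinite not_numeral_le_zero)

lemma finite_A: "finite A" and finite_B: "finite B"
  using simple verts_eq by (auto simp: fin_simple_graph_def)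

lemma path_length: "p \<in> P \<Longrightarrow> 2 \<le> length p"
  using path[of p] u_neq_v by (cases p rule: remdups_adj.cases) (auto simp: is_path_def)

lemma path_0: "p \<in> P \<Longrightarrow> p ! 0 = u"
  using path[of p] by (auto simp: is_path_def hd_conv_nth)

lemma path_last: "p \<in> P \<Longrightarrow> p ! (length p - 1) = v"
  using path[of p] by (auto simp: is_path_def last_conv_nth)

lemma path_distinct: "p \<in> P \<Longrightarrow> distinct p"
  using path[of p] by (auto simp: is_path_def)

text \<open>Treats \<open>(p, i)\<close> as coordinates of a vertex. Distinct paths share only
  \<open>u\<close> and \<open>v\<close>, and each path meets these only at its first and last
  position; so only the ends have several coordinates.\<close>

lemma nth_eq_iff:
  assumes p: "p \<in> P" "i < length p" and q: "q \<in> P" "j < length q"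
  shows "p ! i = q ! j \<longleftrightarrow>
    p = q \<and> i = j \<or> i = 0 \<and> j = 0 \<or> i = length p - 1 \<and> j = length q - 1" (is "?L \<longleftrightarrow> ?R")
proof
  assume ?R
  then show ?L using path_0[OF p(1)] path_0[OF q(1)] path_last[OF p(1)] path_last[OF q(1)]
    by auto
next
  assume L: ?L
  have dp: "k = i" if "p ! k = p ! i" "k < length p" for k
    using path_distinct[OF p(1)] p(2) that by (simp add: nth_eq_iff_index_eq)
  have dq: "k = j" if "q ! k = q ! j" "k < length q" for k
    using path_distinct[OF q(1)] q(2) that by (simp add: nth_eq_iff_index_eq)
  show ?R
  proof (cases "p = q")
    case True
    then show ?thesis using L dp q(2) by auto
  next
    case False
    have "p ! i \<in> set p \<inter> set q" using L p q by (metis IntI nth_mem)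
    then consider "p ! i = u" | "p ! i = v" using inter[OF p(1) q(1) False] by auto
    then show ?thesis
    proof cases
      case 1
      then have "p ! 0 = p ! i" "q ! 0 = q ! j" using L path_0[OF p(1)] path_0[OF q(1)] by auto
      moreover have "0 < length p" "0 < length q" using p q by auto
      ultimately have "0 = i" "0 = j" using dp dq by blast+
      then show ?thesis by simp
    next
      case 2
      then have "length p - 1 = i" "length q - 1 = j"
        using dp[of "length p - 1"] dq[of "length q - 1"] L path_last[OF p(1)] path_last[OF q(1)] p q
        by auto
      then show ?thesis by simp
    qed
  qed
qed

lemma u_in_path: "p \<in> P \<Longrightarrow> u \<in> set p" and v_in_path: "p \<in> P \<Longrightarrow> v \<in> set p"
  using path[of p] by (auto simp: is_path_def)

lemma P_ne: "P \<noteq> {}" using card_P by auto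

lemma ends_notin_leaves: "u \<notin> A" "u \<notin> B" "v \<notin> A" "v \<notin> B"
  using leaves_paths u_in_path v_in_path P_ne by auto

lemma nth_notin_leaves: "p \<in> P \<Longrightarrow> i < length p \<Longrightarrow> p ! i \<notin> A \<and> p ! i \<notin> B"
  using leaves_paths nth_mem[of i p] by blast

lemma path_edge: "p \<in> P \<Longrightarrow> Suc i < length p \<Longrightarrow> {p ! i, p ! Suc i} \<in> edges G"
  unfolding edges_eq using path_edgesI by blast

lemma leaf_edges_A: "a \<in> A \<Longrightarrow> {e \<in> edges G. a \<in> e} = {{u, a}}"
proof
  assume a: "a \<in> A"
  show "{e \<in> edges G. a \<in> e} \<subseteq> {{u, a}}"
  proof
    fix e assume "e \<in> {e \<in> edges G. a \<in> e}"
    then have e: "e \<in> edges G" "a \<in> e" by auto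
    have "e \<notin> path_edges p" if "p \<in> P" for p
      using that a e(2) leaves_paths path_edges_subset[of e p] by blast
    then show "e \<in> {{u, a}}" using e a ends_notin_leaves A_B by (auto simp: edges_eq)
  qed
  show "{{u, a}} \<subseteq> {e \<in> edges G. a \<in> e}" using a by (auto simp: edges_eq)
qed

text \<open>An edge at an inner vertex is no leaf edge and hence lies on some path; the coordinates
  identify this path as \<open>p\<close> and fix the position. Writing the vertex as
  \<open>p ! Suc i\<close> gives both neighbours without subtraction.\<close>

lemma inner_edges:
  assumes p: "p \<in> P" and i: "Suc (Suc i) < length p"
  shows "{e \<in> edges G. p ! Suc i \<in> e} = {{p ! i, p ! Suc i}, {p ! Suc i, p ! Suc (Suc i)}}"
    (is "?L = ?R")
proof
  show "?R \<subseteq> ?L" using path_edge[OF p, of i] path_edge[OF p, of "Suc i"] i by auto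
  show "?L \<subseteq> ?R"
  proof
    fix e assume "e \<in> ?L"
    then have e: "e \<in> edges G" "p ! Suc i \<in> e" by auto
    have "p ! Suc i \<notin> A \<union> B" using nth_notin_leaves[OF p] i by simp
    moreover have "p ! Suc i \<noteq> u"
      using nth_eq_iff[OF p _ p, of "Suc i" 0] i path_0[OF p] path_length[OF p] by force
    moreover have "p ! Suc i \<noteq> v"
      using nth_eq_iff[OF p _ p, of "Suc i" "length p - 1"] i path_last[OF p] by auto
    ultimately obtain q where q: "q \<in> P" "e \<in> path_edges q" using e by (auto simp: edges_eq)
    then obtain j where j: "e = {q ! j, q ! Suc j}" "Suc j < length q" by (auto simp: path_edges_def)
    from e(2) j consider "p ! Suc i = q ! j" | "p ! Suc i = q ! Suc j" by auto
    then show "e \<in> ?R"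
    proof cases
      case 1
      then have "p = q" "j = Suc i" using nth_eq_iff[OF p _ q(1), of "Suc i" j] i j by auto
      then show ?thesis using j by simp
    next
      case 2
      then have "p = q" "j = i" using nth_eq_iff[OF p _ q(1), of "Suc i" "Suc j"] i j by auto
      then show ?thesis using j by simp
    qed
  qed
qed

lemma end_edges: "{e \<in> edges G. u \<in> e} = (\<lambda>p. {u, p ! 1}) ` P \<union> (\<lambda>a. {u, a}) ` A" (is "?L = ?R")
proof
  show "?R \<subseteq> ?L"
  proof -
    have "{u, p ! 1} \<in> edges G" if "p \<in> P" for p
      using path_edge[OF that, of 0] path_0[OF that] path_length[OF that] by simp
    moreover have "{u, a} \<in> edges G" if "a \<in> A" for a using that by (auto simp: edges_eq)
    ultimately show ?thesis by auto
  qed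
  show "?L \<subseteq> ?R"
  proof
    fix e assume "e \<in> ?L"
    then have e: "e \<in> edges G" "u \<in> e" by auto
    show "e \<in> ?R"
    proof (cases "\<exists>a\<in>A. e = {u, a}")
      case False
      then obtain q where q: "q \<in> P" "e \<in> path_edges q"
        using e u_neq_v ends_notin_leaves by (auto simp: edges_eq)
      then obtain j where j: "e = {q ! j, q ! Suc j}" "Suc j < length q" by (auto simp: path_edges_def)
      from e(2) j path_0[OF q(1)] consider "q ! j = q ! 0" | "q ! Suc j = q ! 0" by auto
      moreover have "0 < length q" "j < length q" using j(2) by auto
      ultimately have "j = 0"
        using path_distinct[OF q(1)] j(2) nth_eq_iff_index_eq by (cases; fastforce)
      then show ?thesis using j q path_0[OF q(1)] by auto
    qed auto
  qed
qed

text \<open>A common second vertex of two distinct paths would have to be \<open>v\<close>; then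
  both are the list \<open>[u, v]\<close>, a contradiction.\<close>

lemma inj_on_second: "inj_on (\<lambda>p. {u, p ! 1}) P"
proof (rule inj_onI)
  fix p q assume p: "p \<in> P" and q: "q \<in> P" and eq: "{u, p ! 1} = {u, q ! 1}"
  have l: "2 \<le> length p" "2 \<le> length q" using p q path_length by auto
  have "p ! 1 = q ! 1" using eq by (auto simp: doubleton_eq_iff)
  then consider "p = q" | "length p = 2" "length q = 2"
    using nth_eq_iff[OF p _ q, of 1 1] l by fastforce
  then show "p = q"
  proof cases
    case 2
    then show ?thesis using path_0[OF p] path_0[OF q] \<open>p ! 1 = q ! 1\<close>
      by (intro nth_equalityI) (auto simp: less_2_cases_iff)
  qed
qed

lemma degree_u: "degree G u = card P + card A"
proof -
  have "(\<lambda>p. {u, p ! 1}) ` P \<inter> (\<lambda>a. {u, a}) ` A = {}"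
    using nth_notin_leaves path_length ends_notin_leaves by (fastforce simp: doubleton_eq_iff)
  then have "degree G u = card ((\<lambda>p. {u, p ! 1}) ` P) + card ((\<lambda>a. {u, a}) ` A)"
    unfolding degree_def end_edges using finite_P finite_A by (simp add: card_Un_disjoint)
  moreover have "inj_on (\<lambda>a. {u, a}) A" by (auto simp: inj_on_def doubleton_eq_iff)
  ultimately show ?thesis using inj_on_second by (simp add: card_image)
qed

lemma degree_A: "a \<in> A \<Longrightarrow> degree G a = 1"
  by (simp add: degree_def leaf_edges_A)

lemma degree_inner:
  assumes "p \<in> P" "Suc (Suc i) < length p"
  shows "degree G (p ! Suc i) = 2"
proof -
  have "p ! i \<noteq> p ! Suc (Suc i)" using path_distinct assms by (simp add: nth_eq_iff_index_eq)
  then have "{p ! i, p ! Suc i} \<noteq> {p ! Suc i, p ! Suc (Suc i)}" by (auto simp: doubleton_eq_iff)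
  then show ?thesis unfolding degree_def inner_edges[OF assms] by simp
qed

lemma degree_v: "degree G v = card P + card B"
  using broom.degree_u[OF flip] by (simp add: card_image)

lemma degree_B: "b \<in> B \<Longrightarrow> degree G b = 1"
  using broom.degree_A[OF flip] .

lemma vert_cases:
  assumes "x \<in> verts G"
  obtains "x = u" | "x = v" | "x \<in> A" | "x \<in> B" | p i where "p \<in> P" "Suc (Suc i) < length p" "x = p ! Suc i"
proof -
  consider "x \<in> A" | "x \<in> B" | p i where "p \<in> P" "i < length p" "x = p ! i"
    using assms verts_eq by (auto simp: in_set_conv_nth)
  then show ?thesis
  proof cases
    case (3 p i)
    show ?thesis
    proof (cases i)
      case 0
      then show ?thesis using 3 path_0 that(1) by simp
    next
      case (Suc j)
      show ?thesis
      proof (cases "Suc i = length p")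
        case True
        then have "i = length p - 1" by simp
        then show ?thesis using 3 path_last that(2) by simp
      next
        case False
        then have "Suc (Suc j) < length p" using 3(2) Suc by simp
        then show ?thesis using 3 Suc that(5) by blast
      qed
    qed
  qed (use that(3,4) in blast)+
qed

lemma card_A_pos: "card A > 0" and card_B_pos: "card B > 0"
  using finite_A finite_B A_ne B_ne by (simp_all add: card_gt_0_iff)

text \<open>Only leaves have degree 1, and a path edge touches no leaf; every other vertex has
  degree at least 2 and loses at most one edge.\<close>

lemma no_isolated_delete:
  assumes "p \<in> P" "Suc i < length p"
  shows "no_isolated (delete_edge G {p ! i, p ! Suc i})"
  unfolding no_isolated_def
proof
  fix x assume x: "x \<in> verts (delete_edge G {p ! i, p ! Suc i})"
  have e: "{p ! i, p ! Suc i} \<in> edges G" using assms by (rule path_edge)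
  have "degree G x \<ge> 1 \<and> (x \<in> A \<union> B \<or> degree G x \<ge> 2)"
    by (rule vert_cases[of x])
      (use x degree_u degree_v degree_A degree_B degree_inner card_P in auto)
  moreover have "x \<notin> {p ! i, p ! Suc i}" if "x \<in> A \<union> B"
    using that nth_notin_leaves assms by auto
  ultimately show "degree (delete_edge G {p ! i, p ! Suc i}) x > 0"
    unfolding degree_delete_edge[OF simple e] by auto
qed

text \<open>Once a path has left \<open>u\<close> along some member of \<open>P\<close>, every further step is forced.\<close>

lemma path_in_P:
  assumes c: "is_path u c v" "path_edges c \<subseteq> edges G"
  shows "c \<in> P"
proof -
  have dc: "distinct c" and c0: "c \<noteq> []" "c ! 0 = u" "c ! (length c - 1) = v"
    using c(1) by (auto simp: is_path_def hd_conv_nth last_conv_nth)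
  have ce: "{c ! i, c ! Suc i} \<in> edges G" if "Suc i < length c" for i
    using c(2) path_edgesI[OF that] by blast
  have more: "Suc i < length c" if "i < length c" "c ! i \<noteq> v" for i
  proof (rule ccontr)
    assume "\<not> Suc i < length c"
    then have "i = length c - 1" using that by simp
    then show False using that c0 by simp
  qed
  have l: "Suc 0 < length c" using more[of 0] c0 u_neq_v by auto
  \<comment> \<open>The only neighbour of a leaf in \<open>A\<close> is \<open>u\<close>, so a path
    entering \<open>A\<close> would have to return to \<open>u\<close>.\<close>
  have "c ! 1 \<notin> A"
  proof
    assume a: "c ! 1 \<in> A"
    then have "c ! 1 \<noteq> v" using ends_notin_leaves by auto
    then have l2: "Suc 1 < length c" using more[of 1] l by simp
    then have "{c ! 1, c ! Suc 1} \<in> {e \<in> edges G. c ! 1 \<in> e}" using ce[OF l2] by simp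
    then have "{c ! 1, c ! Suc 1} = {u, c ! 1}"
      by (simp only: leaf_edges_A[OF a] singleton_iff)
    then have "c ! Suc 1 = u" by (auto simp only: doubleton_eq_iff)
    then have "c ! Suc 1 = c ! 0" using c0 by simp
    then show False using dc l2 c0(1) by (simp add: nth_eq_iff_index_eq)
  qed
  moreover have "{u, c ! 1} \<in> (\<lambda>p. {u, p ! 1}) ` P \<union> (\<lambda>a. {u, a}) ` A"
    using ce[OF l] c0 end_edges by auto
  ultimately obtain p where p: "p \<in> P" "p ! 1 = c ! 1" by (auto simp: doubleton_eq_iff)
  note lp = path_length[OF p(1)]
  have step: "Suc i < length p \<longrightarrow> Suc i < length c \<and> c ! i = p ! i \<and> c ! Suc i = p ! Suc i" for i
  proof (induction i)
    case 0
    then show ?case using l c0 p path_0 by simp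
  next
    case (Suc i)
    show ?case
    proof
      assume i: "Suc (Suc i) < length p"
      then have IH: "Suc i < length c" "c ! i = p ! i" "c ! Suc i = p ! Suc i" using Suc by auto
      have "p ! Suc i \<noteq> p ! (length p - 1)"
        using path_distinct[OF p(1)] i by (simp add: nth_eq_iff_index_eq)
      then have "c ! Suc i \<noteq> v" using IH path_last[OF p(1)] by simp
      then have l2: "Suc (Suc i) < length c" using more IH by blast
      have "{c ! Suc i, c ! Suc (Suc i)} \<in> {e \<in> edges G. p ! Suc i \<in> e}"
        using ce[OF l2] IH by auto
      moreover have "c ! Suc (Suc i) \<noteq> c ! i" using dc l2 by (simp add: nth_eq_iff_index_eq)
      ultimately have "c ! Suc (Suc i) = p ! Suc (Suc i)"
        unfolding inner_edges[OF p(1) i] using IH by (auto simp: doubleton_eq_iff)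
      then show "Suc (Suc i) < length c \<and> c ! Suc i = p ! Suc i \<and> c ! Suc (Suc i) = p ! Suc (Suc i)"
        using IH l2 by simp
    qed
  qed
  have eq: "c ! i = p ! i \<and> i < length c" if "i < length p" for i
    using step[of "i - 1"] step[of 0] lp that by (cases i) auto
  \<comment> \<open>The vertex \<open>v\<close> ends \<open>p\<close>, and \<open>c\<close> visits
    it only at its own end; so \<open>c\<close> cannot continue beyond \<open>p\<close>.\<close>
  have "length p - 1 < length c" "c ! (length p - 1) = c ! (length c - 1)"
    using eq[of "length p - 1"] lp path_last[OF p(1)] c0 by auto
  then have "length p - 1 = length c - 1" using dc by (auto simp: nth_eq_iff_index_eq)
  then have "length p = length c" using lp l by simp
  then have "c = p" using eq by (intro nth_equalityI) auto
  then show ?thesis using p by simp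
qed

end

section \<open>Isomorphisms between brooms\<close>

lemma inj_on_Un_disjoint:
  assumes "inj_on f S" "inj_on f T" "f ` S \<inter> f ` T = {}"
  shows "inj_on f (S \<union> T)"
  using assms by (simp add: inj_on_Un) blast

text \<open>By \<open>nth_eq_iff\<close>, whether two coordinates name the same vertex depends only
  on the identity of the paths, the positions and the lengths. All of these are respected by
  \<open>\<sigma>\<close>, so sending each position to the same position on the partner path is well
  defined and injective.\<close>

lemma broom_iso:
  assumes G: "broom G u v P A B" and H: "broom H u' v' P' A' B'"
    and \<sigma>: "bij_betw \<sigma> P P'" and len: "\<And>p. p \<in> P \<Longrightarrow> length (\<sigma> p) = length p"
    and cA: "card A = card A'" and cB: "card B = card B'"
  shows "G \<simeq> H"
proof -
  interpret G: broom G u v P A B by fact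
  interpret H: broom H u' v' P' A' B' by fact
  obtain \<alpha> \<beta> where \<alpha>: "bij_betw \<alpha> A A'" and \<beta>: "bij_betw \<beta> B B'"
    using finite_same_card_bij[OF G.finite_A H.finite_A cA] finite_same_card_bij[OF G.finite_B H.finite_B cB]
    by blast
  have \<sigma>P: "\<sigma> p \<in> P'" if "p \<in> P" for p using \<sigma> that by (auto simp: bij_betw_def)
  have eq_iff: "\<sigma> p ! i = \<sigma> q ! j \<longleftrightarrow> p ! i = q ! j"
    if "p \<in> P" "i < length p" "q \<in> P" "j < length q" for p i q j
  proof -
    have "\<sigma> p = \<sigma> q \<longleftrightarrow> p = q" using \<sigma> that by (auto simp: bij_betw_def inj_on_def)
    then show ?thesis
      using G.nth_eq_iff[OF that] H.nth_eq_iff[OF \<sigma>P _ \<sigma>P, of p i q j] that len by simp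
  qed
  \<comment> \<open>\<open>SOME\<close> picks a value from any coordinate of the vertex; by
    \<open>eq_iff\<close> the choice is immaterial.\<close>
  define f where "f x = (if x \<in> A then \<alpha> x else if x \<in> B then \<beta> x
    else (SOME y. \<exists>p\<in>P. \<exists>i<length p. x = p ! i \<and> y = \<sigma> p ! i))" for x
  have fA: "f x = \<alpha> x" if "x \<in> A" for x using that by (simp add: f_def)
  have fB: "f x = \<beta> x" if "x \<in> B" for x using that G.A_B by (auto simp: f_def)
  have fP: "f (p ! i) = \<sigma> p ! i" if p: "p \<in> P" "i < length p" for p i
  proof -
    let ?Q = "\<lambda>y. \<exists>q\<in>P. \<exists>j<length q. p ! i = q ! j \<and> y = \<sigma> q ! j"
    have "?Q (SOME y. ?Q y)" using p by (intro someI_ex[of ?Q]) blast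
    then obtain q j where q: "q \<in> P" "j < length q" "p ! i = q ! j" "(SOME y. ?Q y) = \<sigma> q ! j"
      by blast
    have "f (p ! i) = (SOME y. ?Q y)" using G.nth_notin_leaves[OF p] by (simp add: f_def)
    then show ?thesis using q eq_iff[OF p q(1,2)] by simp
  qed
  have fmap: "map f p = \<sigma> p" if "p \<in> P" for p
    using fP[OF that] len[OF that] by (intro nth_equalityI) auto
  have fset: "f ` set p = set (\<sigma> p)" if "p \<in> P" for p
    using fmap[OF that] set_map by metis
  have fpath: "(`) f ` path_edges p = path_edges (\<sigma> p)" if "p \<in> P" for p
    using fmap[OF that] path_edges_map by metis
  have imA: "f ` A = A'" and imB: "f ` B = B'"
    using \<alpha> \<beta> fA fB by (auto simp: bij_betw_def)
  have "P' = \<sigma> ` P" using \<sigma> by (simp add: bij_betw_def)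
  then have imP: "f ` (\<Union>p\<in>P. set p) = (\<Union>p\<in>P'. set p)"
    using fset by (simp add: image_UN)
  have fu: "f u = u'" and fv: "f v = v'"
  proof -
    obtain p where p: "p \<in> P" using G.P_ne by blast
    note l = G.path_length[OF p]
    have l': "0 < length p" "length p - 1 < length p" using l by auto
    show "f u = u'" using fP[OF p l'(1)] G.path_0[OF p] H.path_0[OF \<sigma>P[OF p]] by simp
    show "f v = v'" using fP[OF p l'(2)] G.path_last[OF p] H.path_last[OF \<sigma>P[OF p]] len[OF p]
      by simp
  qed
  have "inj_on f (\<Union>p\<in>P. set p)"
  proof (rule inj_onI)
    fix x y assume "x \<in> (\<Union>p\<in>P. set p)" "y \<in> (\<Union>p\<in>P. set p)" and eq: "f x = f y"
    then obtain p i q j where "p \<in> P" "i < length p" "x = p ! i" "q \<in> P" "j < length q" "y = q ! j"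
      by (fastforce simp: in_set_conv_nth)
    then show "x = y" using eq fP eq_iff by simp
  qed
  moreover have "inj_on f A" "inj_on f B" using \<alpha> \<beta> fA fB by (simp_all add: bij_betw_def inj_on_def)
  moreover have "f ` (\<Union>p\<in>P. set p) \<inter> f ` A = {}" "f ` ((\<Union>p\<in>P. set p) \<union> A) \<inter> f ` B = {}"
    unfolding image_Un imA imB imP using H.A_B H.leaves_paths by blast+
  ultimately have "inj_on f (verts G)"
    unfolding G.verts_eq by (intro inj_on_Un_disjoint)
  moreover have "f ` verts G = verts H"
    unfolding G.verts_eq H.verts_eq by (simp only: image_Un imA imB imP)
  moreover have "(`) f ` edges G = edges H"
  proof -
    have "P' = \<sigma> ` P" using \<sigma> by (simp add: bij_betw_def)
    then have "(`) f ` (\<Union>p\<in>P. path_edges p) = (\<Union>p\<in>P'. path_edges p)"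
      using fpath by (simp add: image_UN)
    moreover have "(`) f ` {{u, a} | a. a \<in> A} = {{u', a} | a. a \<in> A'}"
      by (simp add: Setcompr_eq_image image_image fu flip: imA)
    moreover have "(`) f ` {{v, b} | b. b \<in> B} = {{v', b} | b. b \<in> B'}"
      by (simp add: Setcompr_eq_image image_image fv flip: imB)
    ultimately show ?thesis unfolding G.edges_eq H.edges_eq by (simp only: image_Un)
  qed
  ultimately show ?thesis unfolding graph_iso_def bij_betw_def by blast
qed

section \<open>Reconstruction from two cards\<close>

context broom
begin

lemma edges_remove_leaf:
  assumes w: "w \<in> A"
  shows "edges G - {{u, w}} =
    (\<Union>p\<in>P. path_edges p) \<union> {{u, a} | a. a \<in> A - {w}} \<union> {{v, b} | b. b \<in> B}"
proof -
  have "{u, w} \<notin> path_edges p" if "p \<in> P" for p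
    using that w leaves_paths path_edges_subset[of "{u, w}" p] by blast
  moreover have "{u, w} \<noteq> {v, b}" if "b \<in> B" for b
    using that u_neq_v ends_notin_leaves w by (auto simp: doubleton_eq_iff)
  moreover have "{u, w} \<noteq> {u, a}" if "a \<in> A - {w}" for a
    using that by (auto simp: doubleton_eq_iff)
  ultimately show ?thesis unfolding edges_eq by blast
qed

lemma degree_ge_3: "x \<in> verts G \<Longrightarrow> 3 \<le> degree G x \<Longrightarrow> x = u \<or> x = v"
  by (erule vert_cases) (auto simp: degree_A degree_B degree_inner)

text \<open>The frame shared by all cases, with a leaf card and a path card: \<open>rec\<close> has
  to deal only with graphs in which the leaf \<open>w\<close> has moved from \<open>u\<close> to
  another vertex \<open>z\<close> of the right degree.\<close>

lemma reconstruct: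
  assumes w: "w \<in> A" and p: "p \<in> P" "Suc i < length p"
    and rec: "\<And>H z f. \<lbrakk>fin_simple_graph H; z \<in> verts G; z \<noteq> u; z \<noteq> w;
      H = \<lparr>verts = verts G, edges = insert {z, w} (edges G - {{u, w}})\<rparr>;
      Suc (degree G z) = card P + card A;
      f \<in> edges H; edge_degree H f = edge_degree G {p ! i, p ! Suc i};
      delete_edge G {p ! i, p ! Suc i} \<simeq> delete_edge H f\<rbrakk> \<Longrightarrow> G \<simeq> H"
  shows "\<exists>M. M \<subseteq># da_edeck G \<and> size M = 2 \<and> determines M G"
proof (rule determines_two_ecards[OF simple])
  show uw: "{u, w} \<in> edges G" using w by (auto simp: edges_eq)
  show "{p ! i, p ! Suc i} \<in> edges G" using p by (rule path_edge)
  have "w \<notin> {p ! i, p ! Suc i}" using w p nth_notin_leaves by auto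
  then show "{u, w} \<noteq> {p ! i, p ! Suc i}" by blast
  fix H :: "'a ugraph" and f1 f2
  assume H: "fin_simple_graph H" "verts H = verts G"
    and f1: "f1 \<in> edges H" "edges H - {f1} = edges G - {{u, w}}"
      "edge_degree H f1 = edge_degree G {u, w}"
    and f2: "f2 \<in> edges H" "edge_degree H f2 = edge_degree G {p ! i, p ! Suc i}"
      "delete_edge G {p ! i, p ! Suc i} \<simeq> delete_edge H f2"
  \<comment> \<open>The path card supplies what \<open>moved_leaf\<close> needs: \<open>H\<close>
    has at least the edges of a graph without isolated vertices.\<close>
  have "no_isolated (delete_edge H f2)"
    using no_isolated_iso[OF fin_simple_delete_edge[OF simple] f2(3)] no_isolated_delete[OF p] by blast
  then have "no_isolated H"
    unfolding no_isolated_def degree_delete_edge[OF H(1) f2(1)] by auto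
  moreover have "u \<noteq> w" using ends_notin_leaves w by auto
  moreover have "degree G w = 1" using w by (rule degree_A)
  ultimately consider "H = G" | z where "z \<in> verts G" "z \<noteq> u" "z \<noteq> w"
    "H = \<lparr>verts = verts G, edges = insert {z, w} (edges G - {{u, w}})\<rparr>"
    "Suc (degree G z) = card P + card A"
    using moved_leaf[OF simple H _ uw _ _ f1] degree_u by metis
  then show "G \<simeq> H"
  proof cases
    case 1
    then show ?thesis using graph_iso_refl by simp
  next
    case (2 z)
    then show ?thesis using rec[OF H(1) _ _ _ _ _ f2] by blast
  qed
qed

text \<open>The end \<open>v\<close> is listed first because it takes over the role of
  \<open>u\<close> when \<open>H\<close> is compared with \<open>G\<close>;
  \<open>A \<noteq> {w}\<close> leaves a leaf at \<open>u\<close>.\<close>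

lemma move_leaf_to_v:
  assumes H: "fin_simple_graph H"
    "H = \<lparr>verts = verts G, edges = insert {v, w} (edges G - {{u, w}})\<rparr>"
    and w: "w \<in> A" and A: "A \<noteq> {w}"
  shows "broom H v u (rev ` P) (insert w B) (A - {w})"
proof -
  interpret F: broom G v u "rev ` P" B A by (rule flip)
  show ?thesis
  proof
    show "insert w B \<inter> (A - {w}) = {}" using A_B by blast
    show "A - {w} \<noteq> {}" using A w by blast
    show "(insert w B \<union> (A - {w})) \<inter> \<Union> (set ` rev ` P) = {}"
      using F.leaves_paths w by blast
    show "verts H = \<Union> (set ` rev ` P) \<union> insert w B \<union> (A - {w})"
      using F.verts_eq w H(2) by auto
    have "edges G - {{u, w}} = \<Union> (path_edges ` rev ` P) \<union>
        {{u, a} | a. a \<in> A - {w}} \<union> {{v, b} | b. b \<in> B}"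
      unfolding edges_remove_leaf[OF w] by simp
    moreover have "{{v, a} | a. a \<in> insert w B} = insert {v, w} {{v, b} | b. b \<in> B}" by blast
    moreover have "edges H = insert {v, w} (edges G - {{u, w}})" using H(2) by simp
    ultimately show "edges H = \<Union> (path_edges ` rev ` P) \<union> {{v, a} | a. a \<in> insert w B} \<union>
        {{u, b} | b. b \<in> A - {w}}"
      by (simp only: Un_insert_left Un_insert_right ac_simps)
  qed (use H F.u_neq_v F.card_P F.path F.inter in auto)
qed

lemma determined_generic:
  assumes nc: "\<not> (card P = 2 \<and> card A = 1)"
  shows "\<exists>M. M \<subseteq># da_edeck G \<and> size M = 2 \<and> determines M G"
proof -
  obtain w p where w: "w \<in> A" and p: "p \<in> P" using A_ne P_ne by blast
  have "Suc 0 < length p" using path_length[OF p] by simp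
  from w p this show ?thesis
  proof (rule reconstruct)
    fix H z f
    assume H: "fin_simple_graph H"
      "H = \<lparr>verts = verts G, edges = insert {z, w} (edges G - {{u, w}})\<rparr>"
      and z: "z \<in> verts G" "z \<noteq> u" and d: "Suc (degree G z) = card P + card A"
    \<comment> \<open>The sum is at least 3, and \<open>nc\<close> excludes equality. So
      \<open>z\<close> has degree at least 3, which leaves only \<open>v\<close>; its degree then
      gives \<open>u\<close> exactly one leaf more than \<open>v\<close>, and the move exchanges the
      two numbers.\<close>
    have ge: "card P + card A > 3" using nc card_P card_A_pos by linarith
    have "z = v" using degree_ge_3[OF z(1)] z(2) d ge by auto
    then have d': "card A = Suc (card B)" using d degree_v by simp
    then have "A \<noteq> {w}" using card_B_pos by auto
    have Hb: "broom H v u (rev ` P) (insert w B) (A - {w})"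
      using move_leaf_to_v[OF H(1) _ w \<open>A \<noteq> {w}\<close>] H(2) \<open>z = v\<close> by simp
    have "broom G u v P A B" by unfold_locales
    then show "G \<simeq> H"
    proof (rule broom_iso[OF _ Hb])
      show "bij_betw rev P (rev ` P)" by (simp add: bij_betw_def)
      have "w \<notin> B" using w A_B by blast
      then show "card A = card (insert w B)" using d' finite_B by simp
      show "card B = card (A - {w})" using d' w finite_A by simp
    qed simp
  qed
qed

text \<open>Without its only leaf, \<open>u\<close> is an ordinary vertex of the cycle formed by
  \<open>p\<close> and \<open>q\<close>, and \<open>z\<close> becomes an end in its place. One path
  from \<open>z\<close> to \<open>v\<close> is the rest of \<open>p\<close>; the other runs back
  along \<open>p\<close> to \<open>u\<close> and then along \<open>q\<close>.\<close>

lemma move_leaf_to_inner: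
  assumes P: "P = {p, q}" "p \<noteq> q" and A: "A = {w}" and p: "p = r @ z # s" "r \<noteq> []" "s \<noteq> []"
    and H: "fin_simple_graph H"
    "H = \<lparr>verts = verts G, edges = insert {z, w} (edges G - {{u, w}})\<rparr>"
  shows "broom H z v {z # s, rev (r @ [z]) @ tl q} {w} B" (is "broom H z v {?p1, ?p2} _ _")
    "z # s \<noteq> rev (r @ [z]) @ tl q"
proof -
  have pp: "is_path u p v" "is_path u q v" and i: "set p \<inter> set q = {u, v}"
    using path inter P by auto
  obtain r' where r': "r = u # r'" using p pp(1) by (cases r) (auto simp: is_path_def)
  obtain q' where q': "q = u # q'" "q' \<noteq> []"
    using pp(2) u_neq_v by (cases q) (auto simp: is_path_def split: if_splits)
  \<comment> \<open>Both \<open>rev (r @ [z])\<close> and \<open>q\<close> contain the turning point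
    \<open>u\<close>; it is listed once, here as the head of \<open>q\<close>.\<close>
  have p2: "?p2 = rev (r' @ [z]) @ q" by (simp add: r' q')
  have dp: "distinct p" and dq: "distinct q" using pp by (auto simp: is_path_def)
  have vs: "v \<in> set s" and ls: "last s = v" using pp(1) p by (auto simp: is_path_def)
  have us: "u \<notin> set (r' @ z # s)" using dp p r' by auto
  have zv: "z \<noteq> v" using dp p vs by auto
  have disj: "set (r' @ [z]) \<inter> set q = {}"
  proof -
    have "set (r' @ [z]) \<inter> set q \<subseteq> {u, v}" using i p r' by auto
    moreover have "v \<notin> set (r' @ [z])" using vs dp p r' by auto
    ultimately show ?thesis using us by auto
  qed
  have sq: "set s \<inter> set q = {v}"
  proof -
    have "set s \<inter> set q \<subseteq> set p \<inter> set q" using p by auto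
    then have "set s \<inter> set q \<subseteq> {u, v}" using i by simp
    moreover have "u \<notin> set s" "v \<in> set q" using us i by auto
    ultimately show ?thesis using vs by auto
  qed
  show ne: "?p1 \<noteq> ?p2"
  proof
    assume "?p1 = ?p2"
    then have "set ?p1 = set ?p2" by (rule arg_cong)
    then show False using us r' by auto
  qed
  have set2: "set ?p2 = set (r' @ [z]) \<union> set q" unfolding p2 by auto
  have int: "set ?p1 \<inter> set ?p2 = {z, v}"
    unfolding set2 using sq disj dp p r' vs by auto
  have setU: "set ?p1 \<union> set ?p2 = set p \<union> set q" unfolding set2 using p r' q' by auto
  have pe: "path_edges ?p1 \<union> path_edges ?p2 = path_edges p \<union> path_edges q"
  proof -
    have "path_edges ?p2 = path_edges (rev (r' @ [z]) @ [u]) \<union> path_edges q"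
      unfolding p2 using path_edges_append[of "rev (r' @ [z])" u q'] q' by simp
    also have "path_edges (rev (r' @ [z]) @ [u]) = path_edges (rev (r @ [z]))" by (simp add: r')
    also have "\<dots> = path_edges (r @ [z])" by (rule path_edges_rev)
    finally show ?thesis using path_edges_append[of r z s] p by auto
  qed
  show "broom H z v {?p1, ?p2} {w} B"
  proof
    show "fin_simple_graph H" by fact
    show "z \<noteq> v" by fact
    show "2 \<le> card {?p1, ?p2}" using ne by simp
    have "is_path z ?p1 v" using dp p ls by (simp add: is_path_def)
    moreover have "distinct ?p2" unfolding p2 using disj dp dq p r' by auto
    then have "is_path z ?p2 v" using pp(2) q' by (auto simp: is_path_def)
    ultimately show "is_path z t v" if "t \<in> {?p1, ?p2}" for t using that by blast
    show "set t \<inter> set t' = {z, v}" if "t \<in> {?p1, ?p2}" "t' \<in> {?p1, ?p2}" "t \<noteq> t'" for t t'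
      using that int by (elim insertE emptyE) (simp_all add: Int_commute)
    show "{w} \<inter> B = {}" using A_B A by simp
    have PU: "\<Union> (set ` {?p1, ?p2}) = (\<Union>p\<in>P. set p)"
    proof -
      have "\<Union> (set ` {?p1, ?p2}) = set ?p1 \<union> set ?p2"
        by (simp only: image_insert image_empty Union_insert Union_empty Un_empty_right)
      also have "\<dots> = (\<Union>p\<in>P. set p)" unfolding setU using P(1) by simp
      finally show ?thesis .
    qed
    show "({w} \<union> B) \<inter> \<Union> (set ` {?p1, ?p2}) = {}" unfolding PU using leaves_paths A by simp
    show "verts H = \<Union> (set ` {?p1, ?p2}) \<union> {w} \<union> B" unfolding PU using verts_eq A H(2) by simp
    have "edges G - {{u, w}} = path_edges p \<union> path_edges q \<union> {{v, b} | b. b \<in> B}"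
      using edges_remove_leaf[of w] A P by simp
    then show "edges H = \<Union> (path_edges ` {?p1, ?p2}) \<union> {{z, a} | a. a \<in> {w}} \<union> {{v, b} | b. b \<in> B}"
      using H(2) pe by auto
  qed (use B_ne in simp_all)
qed

text \<open>The neighbours of \<open>u\<close> are \<open>v\<close>, \<open>y\<close> and
  \<open>w\<close>, and \<open>v\<close> keeps degree at least 2 after any deletion. So two
  neighbours of degree 1 are \<open>y\<close> and \<open>w\<close>, which forces
  \<open>f = {y, y'}\<close>; but that edge has edge degree 2.\<close>

lemma no_twin_leaves:
  assumes P: "P = {[u, v], [u, y, y', v]}" and A: "A = {w}" and B: "card B = 1"
    and f: "f \<in> edges G" "u \<notin> f" "edge_degree G f = 3"
    and x: "{x, u} \<in> edges G" "{x', u} \<in> edges G" "x \<noteq> x'" "x \<noteq> u" "x' \<noteq> u"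
      "degree (delete_edge G f) x = 1" "degree (delete_edge G f) x' = 1"
  shows False
proof -
  have p: "[u, y, y', v] \<in> P" using P by simp
  have cP: "card P = 2" using P by simp
  have nbr: "t \<in> {v, y, w}" if "{t, u} \<in> edges G" "t \<noteq> u" for t
  proof -
    have "{u, t} \<in> {e \<in> edges G. u \<in> e}" using that by (simp add: insert_commute)
    then have "{u, t} \<in> {{u, v}, {u, y}, {u, w}}" unfolding end_edges P A by auto
    then show ?thesis using that(2) by (auto simp: doubleton_eq_iff)
  qed
  have "degree G v = 3" using degree_v cP B by simp
  then have "degree (delete_edge G f) v \<noteq> 1" using degree_delete_edge[OF simple f(1), of v] by auto
  then have "x \<in> {y, w}" "x' \<in> {y, w}" using nbr x by auto
  then have "degree (delete_edge G f) y = 1" using x by auto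
  moreover have dy: "degree G y = 2" using degree_inner[OF p, of 0] by simp
  ultimately have "y \<in> f" using degree_delete_edge[OF simple f(1), of y] by (auto split: if_splits)
  then have "f \<in> {e \<in> edges G. y \<in> e}" using f(1) by simp
  also have "{e \<in> edges G. y \<in> e} = {{u, y}, {y, y'}}" using inner_edges[OF p, of 0] by simp
  finally have fy: "f = {y, y'}" using f(2) by auto
  have "y \<noteq> y'" using path_distinct[OF p] by simp
  moreover have "degree G y' = 2" using degree_inner[OF p, of 1] by simp
  ultimately show False using edge_degree_eq[OF simple, of y y'] f fy dy by simp
qed

end

section \<open>Cycles with two pendant vertices\<close>

text \<open>The total length is the same, so one pair of paths of equal length forces the remaining
  two to agree in length as well.\<close>

lemma unicyclic_broom_iso:
  assumes G: "broom G u v {p, q} A B" and H: "broom H u' v' {p', q'} A' B'"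
    and ne: "p \<noteq> q" "p' \<noteq> q'" and cards: "card A = card A'" "card B = card B'"
    and sum: "length p + length q = length p' + length q'"
    and r: "r \<in> {p, q}" "r' \<in> {p', q'}" "length r = length r'"
  shows "G \<simeq> H"
proof -
  obtain t where t: "{p, q} = {r, t}" "r \<noteq> t" "length r + length t = length p + length q"
    using that[of q] that[of p] r(1) ne(1) by (auto simp: insert_commute)
  obtain t' where t': "{p', q'} = {r', t'}" "r' \<noteq> t'" "length r' + length t' = length p' + length q'"
    using that[of q'] that[of p'] r(2) ne(2) by (auto simp: insert_commute)
  define \<sigma> where "\<sigma> x = (if x = r then r' else t')" for x
  have "bij_betw \<sigma> {p, q} {p', q'}"
    using t(2) t'(2) unfolding t(1) t'(1) by (auto simp: bij_betw_def \<sigma>_def)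
  moreover have "length (\<sigma> x) = length x" if "x \<in> {p, q}" for x
    using that t t' r(3) sum unfolding t(1) by (auto simp: \<sigma>_def)
  ultimately show ?thesis using broom_iso[OF G H _ _ cards] by blast
qed

lemma iso_via_path:
  assumes G: "fin_simple_graph G" and \<psi>: "iso_via \<psi> G H"
    and p: "is_path x p y" "path_edges p \<subseteq> edges G" "set p \<subseteq> verts G"
  shows "is_path (\<psi> x) (map \<psi> p) (\<psi> y)" "path_edges (map \<psi> p) \<subseteq> edges H"
proof -
  have "inj_on \<psi> (set p)"
    using \<psi> p(3) by (auto simp: iso_via_def bij_betw_def intro: inj_on_subset)
  then show "is_path (\<psi> x) (map \<psi> p) (\<psi> y)"
    using p(1) by (auto simp: is_path_def distinct_map hd_map last_map)
  show "path_edges (map \<psi> p) \<subseteq> edges H"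
    using \<psi> p(2) unfolding path_edges_map by (auto simp: iso_via_def)
qed

context broom
begin

text \<open>By its degree 2, \<open>z\<close> is an inner vertex of some path \<open>p\<close>. Then
  \<open>H\<close> has the same cycle length as \<open>G\<close>, and its path \<open>s\<close> is a
  proper final part of \<open>p\<close>. It remains to read off from the path card one path length
  common to \<open>G\<close> and \<open>H\<close>.\<close>

lemma determined_unicyclic_if:
  assumes P: "card P = 2" and A: "A = {w}" and B: "B = {b}" and t: "t \<in> P" "Suc i < length t"
    and len: "\<And>H z f s s'. \<lbrakk>fin_simple_graph H; broom H z v {s, s'} {w} B; s \<noteq> s';
      \<exists>p\<in>P. \<exists>q\<in>P. p \<noteq> q \<and> 3 \<le> length p \<and>
        length s < length p \<and> length s + length s' = length p + length q;
      f \<in> edges H; edge_degree H f = edge_degree G {t ! i, t ! Suc i};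
      delete_edge G {t ! i, t ! Suc i} \<simeq> delete_edge H f\<rbrakk>
      \<Longrightarrow> \<exists>r\<in>P. \<exists>r'\<in>{s, s'}. length r = length r'"
  shows "\<exists>M. M \<subseteq># da_edeck G \<and> size M = 2 \<and> determines M G"
proof -
  have "w \<in> A" using A by simp
  from this t show ?thesis
  proof (rule reconstruct)
    fix H z f
    assume H: "fin_simple_graph H"
      "H = \<lparr>verts = verts G, edges = insert {z, w} (edges G - {{u, w}})\<rparr>"
      and z: "z \<in> verts G" "z \<noteq> u" and d: "Suc (degree G z) = card P + card A"
      and f: "f \<in> edges H" "edge_degree H f = edge_degree G {t ! i, t ! Suc i}"
      "delete_edge G {t ! i, t ! Suc i} \<simeq> delete_edge H f"
    have dz: "degree G z = 2" using d P A by simp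
    from z(1) obtain p j where p: "p \<in> P" "Suc (Suc j) < length p" "z = p ! Suc j"
      by (rule vert_cases) (use z(2) dz degree_v degree_A degree_B P B in auto)
    obtain q where q: "P = {p, q}" "p \<noteq> q" using P p(1) by (auto simp: card_2_iff)
    \<comment> \<open>Cuts \<open>p\<close> at \<open>z\<close>; both pieces are nonempty since
      \<open>z\<close> is inner.\<close>
    define r s where "r = take (Suc j) p" and "s = drop (Suc (Suc j)) p"
    have rs: "p = r @ z # s" "r \<noteq> []" "s \<noteq> []"
      using p(2,3) id_take_nth_drop[of "Suc j" p] by (auto simp: r_def s_def)
    let ?s = "z # s" and ?s' = "rev (r @ [z]) @ tl q"
    note Hb = move_leaf_to_inner[OF q A rs H]
    have "length r > 0" "length q \<ge> 2" using rs(2) path_length[of q] q by auto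
    then have ls: "length ?s < length p" "length ?s + length ?s' = length p + length q"
      using rs(1) by auto
    have "\<exists>r\<in>P. \<exists>r'\<in>{?s, ?s'}. length r = length r'"
      using H(1) Hb
    proof (rule len[OF _ _ _ _ f])
      show "\<exists>p\<in>P. \<exists>q\<in>P. p \<noteq> q \<and> 3 \<le> length p \<and>
        length ?s < length p \<and> length ?s + length ?s' = length p + length q"
        using q ls p(2) by (intro bexI[of _ p] bexI[of _ q] conjI) simp_all
    qed
    then obtain r0 r' where r': "r0 \<in> {p, q}" "r' \<in> {?s, ?s'}" "length r0 = length r'"
      using q(1) by blast
    have "broom G u v {p, q} A B" using q(1) broom_axioms by simp
    from unicyclic_broom_iso[OF this Hb(1) q(2) Hb(2) _ refl ls(2)[symmetric] r']
    show "G \<simeq> H" using A by simp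
  qed
qed

text \<open>The card has no larger degrees than \<open>H\<close>, and in \<open>H\<close> only the
  two ends have degree at least 3.\<close>

lemma degree_3_image:
  assumes H: "broom H z v' Q A' B'" and f: "f \<in> edges H"
    and \<psi>: "iso_via \<psi> (delete_edge G e) (delete_edge H f)"
    and x: "x \<in> verts G" "degree (delete_edge G e) x = 3"
  shows "\<psi> x = z \<or> \<psi> x = v'" "3 \<le> degree (delete_edge H f) (\<psi> x)"
proof -
  interpret H: broom H z v' Q A' B' by (rule H)
  have "degree (delete_edge H f) (\<psi> x) = 3"
    using iso_via_degree[OF fin_simple_delete_edge[OF simple] \<psi>] x by simp
  then show "3 \<le> degree (delete_edge H f) (\<psi> x)" by simp
  then have "3 \<le> degree H (\<psi> x)" using degree_delete_edge[OF H.simple f] by simp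
  moreover have "\<psi> x \<in> verts H" using \<psi> x(1) by (auto simp: iso_via_def bij_betw_def)
  ultimately show "\<psi> x = z \<or> \<psi> x = v'" using H.degree_ge_3 by blast
qed

text \<open>The card of an edge joining two inner vertices of one path contains the other path, whose ends
  are the only vertices of degree 3; so it shows the distance of the ends along the other path.\<close>

lemma determined_unicyclic_long:
  assumes P: "card P = 2" and A: "A = {w}" and B: "B = {b}" and t: "t \<in> P" "4 \<le> length t"
  shows "\<exists>M. M \<subseteq># da_edeck G \<and> size M = 2 \<and> determines M G"
proof -
  let ?e = "{t ! 1, t ! Suc 1}"
  have "Suc 1 < length t" using t by simp
  with P A B t(1) show ?thesis
  proof (rule determined_unicyclic_if)
    fix H z f s s'
    assume H: "broom H z v {s, s'} {w} B" and f: "f \<in> edges H"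
      and iso: "delete_edge G ?e \<simeq> delete_edge H f"
    interpret H: broom H z v "{s, s'}" "{w}" B by (rule H)
    obtain \<psi> where \<psi>: "iso_via \<psi> (delete_edge G ?e) (delete_edge H f)"
      using iso by (auto simp: graph_iso_iff_iso_via)
    obtain q where q: "P = {t, q}" "t \<noteq> q" using P t(1) by (auto simp: card_2_iff)
    have qP: "q \<in> P" using q by simp
    have e: "?e \<in> edges G" using path_edge[OF t(1), of 1] t(2) by simp
    \<comment> \<open>With at least four entries in \<open>t\<close>, both ends of the deleted edge
      are inner vertices; so \<open>u\<close> and \<open>v\<close> keep degree 3.\<close>
    have "t ! k \<noteq> u \<and> t ! k \<noteq> v" if "k \<in> {1, Suc 1}" for k
    proof -
      have "k < length t" "0 < length t" "length t - 1 < length t" "k \<noteq> 0" "k \<noteq> length t - 1"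
        using that t(2) by auto
      then have "t ! k \<noteq> t ! 0" "t ! k \<noteq> t ! (length t - 1)"
        using nth_eq_iff_index_eq[OF path_distinct[OF t(1)]] by blast+
      then show ?thesis unfolding path_0[OF t(1)] path_last[OF t(1)] by (rule conjI)
    qed
    then have uv: "u \<notin> ?e" "v \<notin> ?e" by auto
    then have deg: "degree (delete_edge G ?e) u = 3" "degree (delete_edge G ?e) v = 3"
      unfolding degree_delete_edge[OF simple e] using degree_u degree_v P A B by simp_all
    have V: "u \<in> verts G" "v \<in> verts G" using verts_eq u_in_path[OF qP] v_in_path[OF qP] qP by auto
    have \<psi>uv: "\<psi> u \<in> {z, v}" "\<psi> v \<in> {z, v}"
      using degree_3_image(1)[OF H f \<psi>] V deg by auto
    have "\<psi> u \<noteq> \<psi> v"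
      using \<psi> V u_neq_v by (auto simp: iso_via_def bij_betw_def inj_on_def)
    have "?e \<notin> path_edges q"
    proof
      assume "?e \<in> path_edges q"
      then have "t ! 1 \<in> set q" using path_edges_subset by blast
      moreover have "t ! 1 \<in> set t" using t(2) by simp
      ultimately show False using inter[OF t(1) qP q(2)] uv by auto
    qed
    then have qe: "path_edges q \<subseteq> edges (delete_edge G ?e)" "set q \<subseteq> verts (delete_edge G ?e)"
      using qP by (auto simp: edges_eq verts_eq)
    note c = iso_via_path[OF fin_simple_delete_edge[OF simple] \<psi> path[OF qP] qe]
    have cH: "path_edges (map \<psi> q) \<subseteq> edges H" using c(2) by auto
    \<comment> \<open>The image of \<open>q\<close> joins the two ends of \<open>H\<close>, so
      \<open>path_in_P\<close> makes it, or its reverse if \<open>\<psi>\<close> exchanges the ends,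
      one of \<open>s\<close> and \<open>s'\<close>.\<close>
    consider "\<psi> u = z" "\<psi> v = v" | "\<psi> u = v" "\<psi> v = z" using \<psi>uv \<open>\<psi> u \<noteq> \<psi> v\<close> by auto
    then have "\<exists>r'\<in>{s, s'}. length q = length r'"
    proof cases
      case 1
      then have "map \<psi> q \<in> {s, s'}" using H.path_in_P c(1) cH by simp
      then show ?thesis by (metis length_map)
    next
      case 2
      then have "rev (map \<psi> q) \<in> {s, s'}" using H.path_in_P is_path_rev[OF c(1)] cH by simp
      then show ?thesis by (metis length_map length_rev)
    qed
    then show "\<exists>r\<in>P. \<exists>r'\<in>{s, s'}. length r = length r'" using qP by blast
  qed
qed

text \<open>If both paths have length 2, the only other candidate has adjacent vertices of degree 3; the
  leaf of \<open>v\<close> and the path vertex cut off from \<open>u\<close> would have to be twins there.\<close>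

lemma determined_unicyclic_short:
  assumes P: "card P = 2" and A: "A = {w}" and B: "B = {b}" and short: "\<And>p. p \<in> P \<Longrightarrow> length p \<le> 3"
    and t: "t \<in> P" "length t = 3"
  shows "\<exists>M. M \<subseteq># da_edeck G \<and> size M = 2 \<and> determines M G"
proof -
  let ?e = "{t ! 0, t ! Suc 0}"
  obtain x where tx: "t = [u, x, v]"
    using path[OF t(1)] t(2) by (auto simp: is_path_def length_Suc_conv numeral_3_eq_3)
  have "Suc 0 < length t" using t by simp
  with P A B t(1) show ?thesis
  proof (rule determined_unicyclic_if)
    fix H z f s s'
    assume H: "broom H z v {s, s'} {w} B" and ne: "s \<noteq> s'"
      and ls: "\<exists>p\<in>P. \<exists>q\<in>P. p \<noteq> q \<and> 3 \<le> length p \<and>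
        length s < length p \<and> length s + length s' = length p + length q"
      and f: "f \<in> edges H" "edge_degree H f = edge_degree G ?e"
      and iso: "delete_edge G ?e \<simeq> delete_edge H f"
    interpret H: broom H z v "{s, s'}" "{w}" B by (rule H)
    \<comment> \<open>As \<open>length s < length p\<close> and \<open>length p \<le> 3\<close>, the
      list \<open>s\<close> has just two entries: \<open>z\<close> and \<open>v\<close> are
      adjacent.\<close>
    obtain p q where pq: "p \<in> P" "q \<in> P" "p \<noteq> q" "length p = 3" "length s = 2"
      "length s + length s' = length p + length q"
      using ls short H.path_length[of s] by (metis One_nat_def add_diff_cancel_left' insertI1 le_antisym
          less_Suc_eq_le numeral_2_eq_2 numeral_3_eq_3)
    show "\<exists>r\<in>P. \<exists>r'\<in>{s, s'}. length r = length r'"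
    proof (cases "length q = 2")
      case True
      then show ?thesis using pq by force
    next
      case False
      then have "length q = 3" using short[OF pq(2)] path_length[OF pq(2)] by simp
      then have "length s' = 4" using pq by simp
      then obtain y y' where s': "s' = [z, y, y', v]"
        using H.path[of s'] by (auto simp: is_path_def length_Suc_conv eval_nat_numeral)
      have s: "s = [z, v]"
        using H.path[of s] pq(5) by (auto simp: is_path_def length_Suc_conv eval_nat_numeral)
      obtain \<psi> where \<psi>: "iso_via \<psi> (delete_edge G ?e) (delete_edge H f)"
        using iso by (auto simp: graph_iso_iff_iso_via)
      let ?D = "delete_edge G ?e" and ?E = "delete_edge H f"
      have D: "fin_simple_graph ?D" using simple by (rule fin_simple_delete_edge)
      have e: "?e \<in> edges G" using path_edge[OF t(1), of 0] t(2) by simp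
      have eux: "?e = {u, x}" using tx by simp
      have ux: "u \<noteq> x" "x \<noteq> v" using path_distinct[OF t(1)] tx by auto
      have bne: "b \<noteq> x" "b \<noteq> v" "b \<noteq> u" using nth_notin_leaves[OF t(1), of 1] ends_notin_leaves tx B by auto
      have dx: "degree G x = 2" using degree_inner[OF t(1), of 0] tx by simp
      have du: "degree G u = 3" using degree_u P A by simp
      have dv: "degree G v = 3" using degree_v P B by simp
      have "edge_degree G ?e = 3"
        using edge_degree_eq[OF simple, of u x] e ux dx du unfolding eux by simp
      then have f3: "edge_degree H f = 3" using f by simp
      \<comment> \<open>In the card \<open>x\<close> and \<open>b\<close> are twins: both have
        degree 1, and both are adjacent to \<open>v\<close>, which still has degree 3.\<close>
      have Ddeg: "degree ?D v = 3" "degree ?D x = 1" "degree ?D b = 1"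
        using degree_delete_edge[OF simple e] dv dx degree_B[of b] B bne ux u_neq_v
        unfolding eux by auto
      have xv: "{x, v} \<in> edges G" using path_edge[OF t(1), of 1] tx by simp
      have bv: "{b, v} \<in> edges G" using B edges_eq by (auto simp: insert_commute)
      have inD: "{x, v} \<in> edges ?D" "{b, v} \<in> edges ?D"
        using xv bv eux ux bne u_neq_v by (auto simp: doubleton_eq_iff)
      have V: "v \<in> verts ?D" "x \<in> verts ?D" "b \<in> verts ?D"
        using edge_subset[OF simple xv] edge_subset[OF simple bv] by auto
      have img: "{\<psi> x, \<psi> v} \<in> edges H" "{\<psi> b, \<psi> v} \<in> edges H"
      proof -
        have eq: "(`) \<psi> ` edges ?D = edges ?E" using \<psi> unfolding iso_via_def by (rule conjunct2)
        have "\<psi> ` g \<in> edges ?E" if "g \<in> edges ?D" for g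
          unfolding eq[symmetric] using that by (rule imageI)
        then have "\<psi> ` g \<in> edges H" if "g \<in> edges ?D" for g using that by auto
        from this[OF inD(1)] this[OF inD(2)] show "{\<psi> x, \<psi> v} \<in> edges H" "{\<psi> b, \<psi> v} \<in> edges H"
          by simp_all
      qed
      have ne': "\<psi> x \<noteq> \<psi> b" "\<psi> x \<noteq> \<psi> v" "\<psi> b \<noteq> \<psi> v"
        using \<psi> V ux bne unfolding iso_via_def bij_betw_def inj_on_def by metis+
      have Edeg: "degree ?E (\<psi> x) = 1" "degree ?E (\<psi> b) = 1"
        using iso_via_degree[OF D \<psi>] V Ddeg by simp_all
      have vcase: "\<psi> v = z \<or> \<psi> v = v" "3 \<le> degree ?E (\<psi> v)"
        using degree_3_image[OF H f(1) \<psi> _ Ddeg(1)] V by simp_all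
      have cH: "card {s, s'} = 2" using ne by simp
      \<comment> \<open>The degree of \<open>\<psi> v\<close> is 3 both in \<open>H\<close> and in
        its card; so \<open>f\<close> avoids \<open>\<psi> v\<close>, as
        \<open>no_twin_leaves\<close> demands.\<close>
      have "degree H (\<psi> v) = 3" using vcase(1) H.degree_u H.degree_v cH B by auto
      then have "\<psi> v \<notin> f" using vcase(2) degree_delete_edge[OF H.simple f(1), of "\<psi> v"] by auto
      from vcase(1) have False
      proof
        assume v: "\<psi> v = z"
        show False
          by (rule H.no_twin_leaves[of y y' w f "\<psi> x" "\<psi> b"])
            (use s s' B f(1) f3 \<open>\<psi> v \<notin> f\<close> img ne' Edeg v in auto)
      next
        assume v: "\<psi> v = v"
        interpret F: broom H v z "rev ` {s, s'}" B "{w}" by (rule H.flip)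
        show False
          by (rule F.no_twin_leaves[of y' y b f "\<psi> x" "\<psi> b"])
            (use s s' B f(1) f3 \<open>\<psi> v \<notin> f\<close> img ne' Edeg v in auto)
      qed
      then show ?thesis ..
    qed
  qed
qed

lemma determined: "\<exists>M. M \<subseteq># da_edeck G \<and> size M = 2 \<and> determines M G"
proof -
  interpret F: broom G v u "rev ` P" B A by (rule flip)
  have cP: "card (rev ` P) = card P" by (simp add: card_image)
  \<comment> \<open>The second case is the first one for the reversed broom; only a cycle with one
    leaf at each end is left.\<close>
  consider "\<not> (card P = 2 \<and> card A = 1)" | "\<not> (card P = 2 \<and> card B = 1)"
    | "card P = 2" "card A = 1" "card B = 1" by blast
  then show ?thesis
  proof cases
    case 1
    then show ?thesis by (rule determined_generic)
  next
    case 2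
    then show ?thesis using F.determined_generic cP by simp
  next
    case 3
    then obtain w b where A: "A = {w}" and B: "B = {b}" by (auto simp: card_1_singleton_iff)
    show ?thesis
    proof (cases "\<exists>t\<in>P. 4 \<le> length t")
      case True
      then show ?thesis using determined_unicyclic_long[OF 3(1) A B] by blast
    next
      case False
      then have short: "length p \<le> 3" if "p \<in> P" for p using that by force
      obtain p q where pq: "P = {p, q}" "p \<noteq> q" using 3(1) by (auto simp: card_2_iff)
      \<comment> \<open>Two paths with two entries each would both be \<open>[u, v]\<close>, but the
        members of \<open>P\<close> are distinct.\<close>
      have "\<exists>t\<in>P. length t = 3"
      proof (rule ccontr)
        assume no: "\<not> ?thesis"
        have two: "r = [u, v]" if "r \<in> P" for r
        proof -
          have "length r \<noteq> 3" using no that by blast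
          then have "length r = 2" using short[OF that] path_length[OF that] by linarith
          then show ?thesis
            using path[OF that] by (auto simp: is_path_def length_Suc_conv eval_nat_numeral)
        qed
        show False using two[of p] two[of q] pq by simp
      qed
      then show ?thesis using determined_unicyclic_short[OF 3(1) A B short] by blast
    qed
  qed
qed

end

theorem theorem2p6:
  fixes G :: "'a ugraph"
  assumes "strong_double_broom G"
  shows "dern G \<in> {1, 2}"
proof -
  from assms obtain u v P A B where "broom G u v P A B"
    unfolding strong_double_broom_def
    by (elim conjE exE) (rule that, rule broom.intro; (assumption | blast))
  then have "\<exists>M. M \<subseteq># da_edeck G \<and> size M = 2 \<and> determines M G" by (rule broom.determined)
  moreover have "verts G \<noteq> {}" using assms by (auto simp: strong_double_broom_def)
  ultimately show ?thesis by (intro dern_in_1_2)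
qed

end
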